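(* Let $n\ge 1$. For every permutation $\pi\in S_n$ with inversion graph $G_\pi$, \[ \ell(\pi) - \ell'(\pi) = \beta(G_\pi) + \bigl(c(\pi) - \kappa(\pi)\bigr). \]
   Context: The Coxeter length $\ell(\pi)$ is the minimum number of simple reflections $s_i=(i,i+1)$, $1\le i\le n-1$, in a product expression for $\pi$. The reflection length $\ell'(\pi)$ is the minimum number of arbitrary transpositions $(i,j)$ in a product expression for $\pi$. $c(\pi)$ is the number of cycles of $\pi$, including fixed points. Inversion graph: $G_\pi$ is the simple graph with vertex set $[n]=\{1,\dots,n\}$ (the values of $\pi$) in which values $a<b$ are adjacent if and only if $b$ appears to the left of $a$ in the one-line notation $\pi(1)\cdots\pi(n)$, i.e. $\pi^{-1}(b)<\pi^{-1}(a)$. Cyclomatic number: $\beta(G) = |E(G)| - |V(G)| + \kappa(G)$, where $\kappa(G)$ is the number of connected components of the graph $G$. Sum components: for $\pi_1\in S_m$, $\pi_2\in S_k$, the direct sum $\pi_1\oplus\pi_2\in S_{m+k}$ has one-line notation that of $\pi_1$ followed by that of $\pi_2$ with every entry increased by $m$. A permutation is sum indecomposable if it is not the direct sum of two nonempty permutations. Every permutation is uniquely $\alpha_1\oplus\cdots\oplus\alpha_k$ with each $\alpha_i$ nonempty and sum indecomposable; the $\alpha_i$ are the sum components of $\pi$, and $\kappa(\pi)$ denotes their number. (It is a known fact that $\kappa(\pi)=\kappa(G_\pi)$.) *)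

theory Defs
  imports "HOL-Combinatorics.Combinatorics"
begin

text \<open>An element of the symmetric group on \<open>n\<close> letters is a function \<open>\<pi>\<close> with
  \<open>\<pi> permutes {1..n}\<close>, the one-line notation being \<open>\<pi> 1, \<dots>, \<pi> n\<close>.\<close>

definition word_length :: "('a \<Rightarrow> 'a) set \<Rightarrow> ('a \<Rightarrow> 'a) \<Rightarrow> nat" where
  "word_length S \<pi> = (LEAST k. \<exists>ts. length ts = k \<and> set ts \<subseteq> S \<and> foldr (\<circ>) ts id = \<pi>)"

definition coxeter_length :: "nat \<Rightarrow> (nat \<Rightarrow> nat) \<Rightarrow> nat" where
  "coxeter_length n = word_length {transpose i (i + 1) | i. 1 \<le> i \<and> i + 1 \<le> n}"

definition reflection_length :: "nat \<Rightarrow> (nat \<Rightarrow> nat) \<Rightarrow> nat" where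
  "reflection_length n = word_length {transpose i j | i j. 1 \<le> i \<and> i < j \<and> j \<le> n}"

text \<open>A cycle is identified with its support; a fixed point \<open>i\<close> contributes \<open>{i}\<close>.\<close>

definition num_cycles :: "nat \<Rightarrow> (nat \<Rightarrow> nat) \<Rightarrow> nat" where
  "num_cycles n \<pi> = card (orbit \<pi> ` {1..n})"

text \<open>A simple graph is a pair of a vertex set and a set of two-element subsets of it.\<close>

type_synonym 'a sgraph = "'a set \<times> 'a set set"

definition connected_components :: "'a sgraph \<Rightarrow> 'a set set" where
  "connected_components G =
     fst G // {(u, v). u \<in> fst G \<and> v \<in> fst G \<and> (u, v) \<in> {(x, y). {x, y} \<in> snd G}\<^sup>*}"

definition cyclomatic_number :: "'a sgraph \<Rightarrow> int" where
  "cyclomatic_number G =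
     int (card (snd G)) - int (card (fst G)) + int (card (connected_components G))"

definition inversion_graph :: "nat \<Rightarrow> (nat \<Rightarrow> nat) \<Rightarrow> nat sgraph" where
  "inversion_graph n \<pi> =
     ({1..n}, {{a, b} | a b. a \<in> {1..n} \<and> b \<in> {1..n} \<and> a < b \<and> inv \<pi> b < inv \<pi> a})"

text \<open>Direct sums are formed on one-line notations, since a function permuting \<open>{1..n}\<close> does not
  determine \<open>n\<close>.\<close>

definition one_line :: "nat \<Rightarrow> (nat \<Rightarrow> nat) \<Rightarrow> nat list" where
  "one_line n \<pi> = map \<pi> [1..<n + 1]"

definition perm_word :: "nat list \<Rightarrow> bool" where
  "perm_word w \<longleftrightarrow> distinct w \<and> set w = {1..length w}"

definition direct_sum :: "nat list \<Rightarrow> nat list \<Rightarrow> nat list" where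
  "direct_sum u v = u @ map (\<lambda>x. x + length u) v"

definition sum_indecomposable :: "nat list \<Rightarrow> bool" where
  "sum_indecomposable w \<longleftrightarrow>
     \<not> (\<exists>u v. perm_word u \<and> perm_word v \<and> u \<noteq> [] \<and> v \<noteq> [] \<and> w = direct_sum u v)"

definition sum_decomposition :: "nat list \<Rightarrow> nat list list \<Rightarrow> bool" where
  "sum_decomposition w ws \<longleftrightarrow>
     (\<forall>u \<in> set ws. perm_word u \<and> u \<noteq> [] \<and> sum_indecomposable u) \<and> foldr direct_sum ws [] = w"

definition sum_components :: "nat list \<Rightarrow> nat list list" where
  "sum_components w = (THE ws. sum_decomposition w ws)"

definition num_sum_components :: "nat \<Rightarrow> (nat \<Rightarrow> nat) \<Rightarrow> nat" where
  "num_sum_components n \<pi> = length (sum_components (one_line n \<pi>))"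

text \<open>The definite description in \<open>sum_components\<close> is justified by existence and uniqueness of
  the decomposition.\<close>

lemma perm_word_one_line:
  assumes "\<pi> permutes {1..n}"
  shows "perm_word (one_line n \<pi>)"
proof -
  have "set [1..<n + 1] = {1..n}" by auto
  then show ?thesis
    using permutes_image[OF assms] permutes_inj_on[OF assms]
    by (simp add: perm_word_def one_line_def distinct_map del: upt_Suc)
qed

lemma direct_sum_assoc: "direct_sum (direct_sum u v) w = direct_sum u (direct_sum v w)"
  by (simp add: direct_sum_def add.assoc add.commute)

lemma perm_word_direct_sum:
  assumes "perm_word u" "perm_word v"
  shows "perm_word (direct_sum u v)"
proof -
  have im: "(\<lambda>x. x + length u) ` {1..length v} = {length u + 1..length u + length v}"
    by (simp add: image_add_atLeastAtMost' add.commute)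
  have "distinct (map (\<lambda>x. x + length u) v)"
    using assms by (simp add: perm_word_def distinct_map)
  then show ?thesis
    using assms im unfolding perm_word_def direct_sum_def
    by (auto simp: ivl_disj_un)
qed

lemma sum_decomposition_append:
  "foldr direct_sum (us @ vs) [] = direct_sum (foldr direct_sum us []) (foldr direct_sum vs [])"
proof (induction us)
  case Nil
  then show ?case by (simp add: direct_sum_def)
next
  case (Cons a us)
  then show ?case by (simp add: direct_sum_assoc)
qed

lemma sum_decomposition_exists:
  assumes "perm_word w"
  shows "\<exists>ws. sum_decomposition w ws"
  using assms
proof (induction w rule: length_induct)
  case (1 w)
  consider "w = []" | "w \<noteq> []" "sum_indecomposable w" | "\<not> sum_indecomposable w" by blast
  then show ?case
  proof cases
    case 1
    then have "sum_decomposition w []" by (simp add: sum_decomposition_def)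
    then show ?thesis ..
  next
    case 2
    then have "sum_decomposition w [w]"
      using 1 by (simp add: sum_decomposition_def direct_sum_def)
    then show ?thesis ..
  next
    case 3
    then obtain u v where uv: "perm_word u" "perm_word v" "u \<noteq> []" "v \<noteq> []" "w = direct_sum u v"
      unfolding sum_indecomposable_def by blast
    then have "length u < length w" "length v < length w" by (auto simp: direct_sum_def)
    then obtain us vs where "sum_decomposition u us" "sum_decomposition v vs"
      using 1 uv by meson
    then have "sum_decomposition w (us @ vs)"
      using uv(5) sum_decomposition_append[of us vs] by (auto simp: sum_decomposition_def)
    then show ?thesis ..
  qed
qed

lemma direct_sum_inject:
  assumes "direct_sum u v = direct_sum u v'"
  shows "v = v'"
proof -
  have "map (\<lambda>x. x + length u) v = map (\<lambda>x. x + length u) v'"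
    using assms by (simp add: direct_sum_def)
  moreover have "inj (\<lambda>x. x + length u)" by (simp add: inj_def)
  ultimately show ?thesis by (simp only: inj_map_eq_map)
qed

lemma prefix_not_indecomposable:
  assumes "perm_word u" "u \<noteq> []" "perm_word (u @ t)" "t \<noteq> []"
  shows "\<not> sum_indecomposable (u @ t)"
proof -
  let ?v = "map (\<lambda>x. x - length u) t"
  have set_t: "set t = {length u + 1..length u + length t}"
  proof -
    have "set t = {1..length u + length t} - {1..length u}"
      using assms(1,3) by (auto simp: perm_word_def)
    also have "\<dots> = {length u + 1..length u + length t}" by auto
    finally show ?thesis .
  qed
  have inj: "inj_on (\<lambda>x. x - length u) (set t)"
    unfolding set_t by (auto intro!: inj_onI)
  have "(\<lambda>x. x - length u) ` set t = {1..length t}"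
  proof -
    have "x \<in> (\<lambda>x. x - length u) ` set t" if "x \<in> {1..length t}" for x
      using that set_t by (intro image_eqI[of _ _ "x + length u"]) auto
    then show ?thesis using set_t by auto
  qed
  then have "perm_word ?v"
    using inj assms(3) by (simp add: perm_word_def distinct_map)
  moreover have "map (\<lambda>x. x + length u) ?v = t"
    unfolding map_map by (rule map_idI) (auto simp: set_t)
  then have "u @ t = direct_sum u ?v" by (simp add: direct_sum_def)
  ultimately show ?thesis
    using assms unfolding sum_indecomposable_def by (metis map_is_Nil_conv)
qed

lemma sum_decomposition_unique:
  assumes "sum_decomposition w ws" "sum_decomposition w ws'"
  shows "ws = ws'"
  using assms
proof (induction ws arbitrary: w ws')
  case Nil
  then show ?case
    by (cases ws') (auto simp: sum_decomposition_def direct_sum_def)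
next
  case (Cons u us)
  then obtain u' us' where ws': "ws' = u' # us'"
    by (cases ws') (auto simp: sum_decomposition_def direct_sum_def)
  define r where "r = foldr direct_sum us []"
  define r' where "r' = foldr direct_sum us' []"
  have eq: "direct_sum u r = direct_sum u' r'"
    using Cons.prems by (simp add: sum_decomposition_def ws' r_def r'_def)
  have u: "perm_word u" "u \<noteq> []" "sum_indecomposable u"
    and u': "perm_word u'" "u' \<noteq> []" "sum_indecomposable u'"
    using Cons.prems by (auto simp: sum_decomposition_def ws')
  obtain t where "u = u' @ t \<or> u' = u @ t"
    using eq unfolding direct_sum_def append_eq_append_conv2 by blast
  then have "u = u'"
    using prefix_not_indecomposable u u' by (metis append_Nil2)
  then have "r = r'" using eq direct_sum_inject by blast
  then have "us = us'"
    using Cons.prems by (intro Cons.IH[of r]) (auto simp: sum_decomposition_def ws' r_def r'_def)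
  with \<open>u = u'\<close> show ?case by (simp add: ws')
qed

lemma sum_decomposition_sum_components:
  assumes "\<pi> permutes {1..n}"
  shows "sum_decomposition (one_line n \<pi>) (sum_components (one_line n \<pi>))"
  unfolding sum_components_def
  using sum_decomposition_exists[OF perm_word_one_line[OF assms]] sum_decomposition_unique
  by (metis theI)

end

theory Submission
  imports Defs
begin

text \<open>The identity is assembled from three separate evaluations. The Coxeter length of \<open>\<pi>\<close> is its
  number of inversions, that is, the number of edges of \<open>G\<^sub>\<pi>\<close>; the reflection length is
  \<open>n - c(\<pi>)\<close>; and the number of sum components is the number of connected components of \<open>G\<^sub>\<pi>\<close>.
  The last of these makes \<open>\<kappa>\<close> cancel on the right-hand side, where \<open>|E| - n + c(\<pi>)\<close> remains,
  and this is the difference of the two lengths.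

  Both lengths come from one principle (\<open>word_length_eqI\<close>): a statistic that vanishes at the
  identity, grows by at most one under each generator, and can be decreased by some generator
  at every other element, is the word length. A simple reflection \<open>s\<^sub>i\<close> changes only the
  relative order of the values \<open>i\<close> and \<open>i + 1\<close>, so it toggles one inversion, and every permutation
  other than the identity has an inverted pair of adjacent values. A transposition merges at most
  two cycles into one, and a non-fixed point can be split off from its cycle.

  The components are compared through the cuts of \<open>\<pi>\<close>, the \<open>k\<close> for which \<open>\<pi>\<close> preserves
  \<open>{1..k}\<close>. Sum components end exactly at the cuts. On the other side, \<open>k\<close> is a cut exactly when no
  edge of \<open>G\<^sub>\<pi>\<close> joins a value at most \<open>k\<close> to a larger one, and the largest value in a connected
  component always has this property. Since different cuts lie in different components, sending a
  cut to its component is a bijection.\<close>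

section \<open>Word length as a statistic on permutations\<close>

text \<open>The growth condition bounds every word from below by the statistic; following decreasing
  generators down to the identity and back up, which is possible because they are involutions,
  produces a word that attains the bound.\<close>

lemma word_length_eqI:
  fixes f :: "('a \<Rightarrow> 'a) \<Rightarrow> nat"
  assumes id: "P id" "f id = 0"
    and closed: "\<And>s p. s \<in> S \<Longrightarrow> P p \<Longrightarrow> P (s \<circ> p)"
    and grow: "\<And>s p. s \<in> S \<Longrightarrow> P p \<Longrightarrow> f (s \<circ> p) \<le> f p + 1"
    and descend: "\<And>p. P p \<Longrightarrow> p \<noteq> id \<Longrightarrow> \<exists>s\<in>S. f (s \<circ> p) < f p"
    and involution: "\<And>s. s \<in> S \<Longrightarrow> s \<circ> s = id"
    and p: "P p"
  shows "word_length S p = f p"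
proof -
  have lower: "P (foldr (\<circ>) ts id) \<and> f (foldr (\<circ>) ts id) \<le> length ts" if "set ts \<subseteq> S" for ts
    using that
  proof (induction ts)
    case Nil
    show ?case using id by (simp add: id_def)
  next
    case (Cons t ts)
    let ?p = "foldr (\<circ>) ts id"
    have t: "t \<in> S" and ts: "set ts \<subseteq> S" using Cons.prems by simp_all
    have p: "P ?p" "f ?p \<le> length ts" using Cons.IH[OF ts] by blast+
    have "f (t \<circ> ?p) \<le> length (t # ts)" using grow[OF t p(1)] p(2) by (simp only: list.size)
    moreover have "foldr (\<circ>) (t # ts) id = t \<circ> ?p" by (simp only: foldr.simps o_apply)
    ultimately show ?case using closed[OF t p(1)] by (simp only: simp_thms)
  qed
  have upper: "\<exists>ts. length ts \<le> f p \<and> set ts \<subseteq> S \<and> foldr (\<circ>) ts id = p"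
    using p
  proof (induction "f p" arbitrary: p rule: less_induct)
    case less
    show ?case
    proof (cases "p = id")
      case True
      then show ?thesis by (intro exI[of _ "[]"]) simp
    next
      case False
      then obtain s where s: "s \<in> S" "f (s \<circ> p) < f p" using descend less.prems by blast
      then obtain ts where ts: "length ts \<le> f (s \<circ> p)" "set ts \<subseteq> S" "foldr (\<circ>) ts id = s \<circ> p"
        using less.hyps closed less.prems by blast
      have "foldr (\<circ>) (s # ts) id = p"
        using ts(3) involution[OF s(1)] by (simp add: o_assoc)
      then show ?thesis using s ts by (intro exI[of _ "s # ts"]) auto
    qed
  qed
  then obtain ts where ts: "length ts \<le> f p" "set ts \<subseteq> S" "foldr (\<circ>) ts id = p" by blast
  show ?thesis
    unfolding word_length_def
  proof (rule Least_equality)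
    show "\<exists>us. length us = f p \<and> set us \<subseteq> S \<and> foldr (\<circ>) us id = p"
      using ts lower[OF ts(2)] by (intro exI[of _ ts]) auto
  next
    fix k
    assume "\<exists>us. length us = k \<and> set us \<subseteq> S \<and> foldr (\<circ>) us id = p"
    then show "f p \<le> k" using lower by blast
  qed
qed

section \<open>Reflection length and cycles\<close>

lemma num_cycles_id: "num_cycles n id = n"
proof -
  have "orbit id x = {x}" for x :: nat by (simp add: orbit_eq_singleton_iff)
  then show ?thesis by (simp add: num_cycles_def card_image)
qed

lemma num_cycles_le: "num_cycles n p \<le> n"
  unfolding num_cycles_def using card_image_le[of "{1..n}" "orbit p"] by simp

lemma orbit_transpose_comp:
  assumes "permutation p" "i \<notin> orbit p x" "j \<notin> orbit p x"
  shows "orbit (transpose i j \<circ> p) x = orbit p x"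
proof (rule orbit_cong)
  show "x \<in> orbit p x" using assms(1) by (rule permutation_self_in_orbit)
next
  fix y
  assume "y \<in> orbit p x"
  then have "p y \<in> orbit p x" by (rule orbit.step)
  then have "p y \<noteq> i" "p y \<noteq> j" using assms by auto
  then show "(transpose i j \<circ> p) y = p y" by simp
qed

lemma orbit_eq_if_mem:
  assumes "permutation p" "y \<in> orbit p x"
  shows "orbit p x = orbit p y"
  using orbit_cyclic_eq3[OF cyclic_on_orbit'[OF assms(1)] assms(2)] by simp

lemma surviving_orbits:
  fixes n :: nat
  assumes "p permutes {1..n}"
  shows "orbit p ` {1..n} - {orbit p i, orbit p j} \<subseteq> orbit (transpose i j \<circ> p) ` {1..n}"
proof
  fix C
  assume C: "C \<in> orbit p ` {1..n} - {orbit p i, orbit p j}"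
  then obtain x where x: "x \<in> {1..n}" "C = orbit p x" by blast
  have perm: "permutation p" using assms by (rule permutes_imp_permutation[OF finite_atLeastAtMost])
  have "i \<notin> orbit p x" "j \<notin> orbit p x"
    using C x(2) orbit_eq_if_mem[OF perm] by auto
  then show "C \<in> orbit (transpose i j \<circ> p) ` {1..n}"
    using orbit_transpose_comp[OF perm, of i x j] x by (intro image_eqI[of _ _ x]) simp_all
qed

text \<open>Only the cycles through \<open>i\<close> and \<open>j\<close> can be destroyed, and at least one cycle, the new one
  through \<open>i\<close>, replaces them.\<close>

lemma num_cycles_transpose_ge:
  assumes p: "p permutes {1..n}" and ij: "i \<in> {1..n}" "j \<in> {1..n}"
  shows "num_cycles n p \<le> num_cycles n (transpose i j \<circ> p) + 1"
proof -
  let ?q = "transpose i j \<circ> p"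
  let ?A = "orbit p ` {1..n} - {orbit p i, orbit p j}"
  have q: "?q permutes {1..n}" using p ij by (intro permutes_compose permutes_swap_id)
  have perm: "permutation p" "permutation ?q"
    using p q by (simp_all only: permutes_imp_permutation[OF finite_atLeastAtMost])
  have new: "orbit ?q i \<notin> ?A"
  proof
    assume "orbit ?q i \<in> ?A"
    then obtain x where x: "orbit ?q i = orbit p x" "orbit p x \<noteq> orbit p i" by auto
    then have "i \<in> orbit p x" using permutation_self_in_orbit[OF perm(2), of i] by simp
    then show False using x orbit_eq_if_mem[OF perm(1)] by blast
  qed
  have "card (orbit p ` {1..n}) \<le> card ?A + card {orbit p i, orbit p j}"
    using diff_card_le_card_Diff[of "{orbit p i, orbit p j}" "orbit p ` {1..n}"] by simp
  also have "card {orbit p i, orbit p j} \<le> 2" by (simp add: card_insert_if)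
  also have "card ?A + 2 = card (insert (orbit ?q i) ?A) + 1" using new by simp
  also have "card (insert (orbit ?q i) ?A) \<le> card (orbit ?q ` {1..n})"
    using surviving_orbits[OF p, of i j] ij by (intro card_mono) auto
  finally show ?thesis by (simp add: num_cycles_def)
qed

text \<open>Composing with the transposition of \<open>i\<close> and \<open>p i\<close> makes \<open>i\<close> a fixed point and leaves
  the rest of its cycle, which still contains \<open>p i\<close>, as a second cycle.\<close>

lemma num_cycles_split:
  assumes p: "p permutes {1..n}" and i: "p i \<noteq> i"
  shows "num_cycles n p < num_cycles n (transpose i (p i) \<circ> p)"
proof -
  let ?q = "transpose i (p i) \<circ> p"
  let ?A = "orbit p ` {1..n} - {orbit p i}"
  have i_in: "i \<in> {1..n}" using p i by (meson permutes_not_in)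
  then have pi_in: "p i \<in> {1..n}" using p by (simp only: permutes_in_image)
  have q: "?q permutes {1..n}" using p i_in pi_in by (intro permutes_compose permutes_swap_id)
  have perm: "permutation p" "permutation ?q"
    using p q by (simp_all only: permutes_imp_permutation[OF finite_atLeastAtMost])
  have same: "orbit p (p i) = orbit p i" using perm(1) by (rule permutation_orbit_step)
  have fixed: "orbit ?q i = {i}" by (simp add: orbit_eq_singleton_iff)
  have self: "p i \<in> orbit ?q (p i)" using perm(2) by (rule permutation_self_in_orbit)
  have not_A: "C \<notin> ?A" if "x \<in> C" "x \<in> orbit p i" for C x
    using that orbit_eq_if_mem[OF perm(1)] by blast
  have "orbit ?q i \<notin> ?A"
    using not_A[of i] fixed permutation_self_in_orbit[OF perm(1), of i] by blast
  moreover have "orbit ?q (p i) \<notin> ?A"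
    using not_A[OF self] by (simp add: orbit.base)
  moreover have "orbit ?q i \<noteq> orbit ?q (p i)" using fixed self i by auto
  ultimately have "card (insert (orbit ?q i) (insert (orbit ?q (p i)) ?A)) = card ?A + 2" by simp
  moreover have "card (insert (orbit ?q i) (insert (orbit ?q (p i)) ?A)) \<le> card (orbit ?q ` {1..n})"
    using surviving_orbits[OF p, of i "p i"] i_in pi_in same by (intro card_mono) auto
  moreover have "card (orbit p ` {1..n}) = card ?A + 1"
    using i_in card_Suc_Diff1[of "orbit p ` {1..n}" "orbit p i"] by simp
  ultimately show ?thesis by (simp add: num_cycles_def)
qed

lemma reflection_length_eq:
  assumes "p permutes {1..n}"
  shows "reflection_length n p = n - num_cycles n p"
  unfolding reflection_length_def
proof (rule word_length_eqI[where P = "\<lambda>p. p permutes {1..n}"])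
  let ?S = "{transpose i j | i j. 1 \<le> i \<and> i < j \<and> j \<le> n}"
  show "id permutes {1..n}" by (rule permutes_id)
  show "n - num_cycles n id = 0" by (simp add: num_cycles_id)
  show "s \<circ> s = id" if "s \<in> ?S" for s using that by auto
  show "s \<circ> p permutes {1..n}" if "s \<in> ?S" "p permutes {1..n}" for s p
    using that by (auto intro!: permutes_compose permutes_swap_id)
  show "n - num_cycles n (s \<circ> p) \<le> n - num_cycles n p + 1"
    if s: "s \<in> ?S" and p: "p permutes {1..n}" for s p
  proof -
    obtain i j where "s = transpose i j" "i \<in> {1..n}" "j \<in> {1..n}" using s by auto
    then show ?thesis using num_cycles_transpose_ge[OF p, of i j] by simp
  qed
  show "\<exists>s\<in>?S. n - num_cycles n (s \<circ> p) < n - num_cycles n p"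
    if p: "p permutes {1..n}" and "p \<noteq> id" for p
  proof -
    obtain i where i: "p i \<noteq> i" using \<open>p \<noteq> id\<close> by (auto simp: fun_eq_iff)
    then have i_in: "i \<in> {1..n}" using p by (meson permutes_not_in)
    then have pi_in: "p i \<in> {1..n}" using p by (simp only: permutes_in_image)
    have "transpose i (p i) \<in> ?S"
    proof (cases "i < p i")
      case True
      then show ?thesis using i_in pi_in by auto
    next
      case False
      then have "p i < i" using i by simp
      then show ?thesis using i_in pi_in by (subst transpose_commute) auto
    qed
    moreover have "n - num_cycles n (transpose i (p i) \<circ> p) < n - num_cycles n p"
      using num_cycles_split[OF p i] num_cycles_le[of n "transpose i (p i) \<circ> p"] by simp
    ultimately show ?thesis by blast
  qed
qed (fact assms)

section \<open>Coxeter length and inversions\<close>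

text \<open>These are the inversions of \<open>g\<close> by position. With \<open>g = inv \<pi>\<close> they are the inversions of
  \<open>\<pi>\<close> by value, that is, the edges of \<open>G\<^sub>\<pi>\<close>.\<close>

definition inversions :: "nat \<Rightarrow> (nat \<Rightarrow> nat) \<Rightarrow> (nat \<times> nat) set" where
  "inversions n g = {(a, b). a \<in> {1..n} \<and> b \<in> {1..n} \<and> a < b \<and> g b < g a}"

lemma finite_inversions: "finite (inversions n g)"
  by (rule finite_subset[of _ "{1..n} \<times> {1..n}"]) (auto simp: inversions_def)

lemma card_inversion_graph_edges:
  "card (snd (inversion_graph n p)) = card (inversions n (inv p))"
proof -
  have "snd (inversion_graph n p) = (\<lambda>(a, b). {a, b}) ` inversions n (inv p)"
    by (auto simp: inversion_graph_def inversions_def image_iff)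
  moreover have "inj_on (\<lambda>(a, b). {a, b}) (inversions n (inv p))"
    by (rule inj_onI) (auto simp: inversions_def doubleton_eq_iff)
  ultimately show ?thesis by (simp add: card_image)
qed

text \<open>The transposition of \<open>i\<close> and \<open>i + 1\<close> preserves the order of every pair of numbers except
  the pair \<open>(i, i + 1)\<close>, so it carries all other inversions to inversions.\<close>

lemma card_inversions_adjacent:
  assumes i: "1 \<le> i" "i + 1 \<le> n"
  shows "card (inversions n (g \<circ> transpose i (i + 1)) - {(i, i + 1)})
    = card (inversions n g - {(i, i + 1)})"
proof -
  let ?s = "transpose i (i + 1)"
  have carry: "(?s a, ?s b) \<in> inversions n (h \<circ> ?s) - {(i, i + 1)}"
    if "(a, b) \<in> inversions n h - {(i, i + 1)}" for a b h
    using that i by (auto simp: inversions_def transpose_def split: if_splits)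
  have "bij_betw (\<lambda>(a, b). (?s a, ?s b)) (inversions n g - {(i, i + 1)})
      (inversions n (g \<circ> ?s) - {(i, i + 1)})"
  proof (rule bij_betw_byWitness[where f' = "\<lambda>(a, b). (?s a, ?s b)"])
    show "(\<lambda>(a, b). (?s a, ?s b)) ` (inversions n g - {(i, i + 1)})
        \<subseteq> inversions n (g \<circ> ?s) - {(i, i + 1)}"
      using carry by auto
    have "g \<circ> ?s \<circ> ?s = g" by (simp add: comp_assoc)
    then show "(\<lambda>(a, b). (?s a, ?s b)) ` (inversions n (g \<circ> ?s) - {(i, i + 1)})
        \<subseteq> inversions n g - {(i, i + 1)}"
      using carry[of _ _ "g \<circ> ?s"] by auto
  qed auto
  then show ?thesis by (simp add: bij_betw_same_card)
qed

lemma card_inversions_adjacent_le: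
  assumes "1 \<le> i" "i + 1 \<le> n"
  shows "card (inversions n (g \<circ> transpose i (i + 1))) \<le> card (inversions n g) + 1"
proof -
  let ?h = "g \<circ> transpose i (i + 1)"
  have "card (inversions n ?h) \<le> card (inversions n ?h - {(i, i + 1)}) + 1"
    using diff_card_le_card_Diff[of "{(i, i + 1)}" "inversions n ?h"] by simp
  also have "\<dots> = card (inversions n g - {(i, i + 1)}) + 1"
    by (simp only: card_inversions_adjacent[OF assms])
  also have "\<dots> \<le> card (inversions n g) + 1"
    by (simp add: card_mono finite_inversions)
  finally show ?thesis .
qed

lemma card_inversions_descent:
  assumes i: "1 \<le> i" "i + 1 \<le> n" and desc: "g (i + 1) < g i"
  shows "card (inversions n (g \<circ> transpose i (i + 1))) < card (inversions n g)"
proof -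
  let ?h = "g \<circ> transpose i (i + 1)"
  have "(i, i + 1) \<notin> inversions n ?h" using desc by (simp add: inversions_def)
  then have "card (inversions n ?h) = card (inversions n g - {(i, i + 1)})"
    using card_inversions_adjacent[OF i, of g] by simp
  also have "\<dots> < card (inversions n g)"
    using i desc finite_inversions by (intro card_Diff1_less) (auto simp: inversions_def)
  finally show ?thesis .
qed

text \<open>Without a descent \<open>g\<close> would be increasing, hence \<open>g x \<ge> x\<close> throughout, which forces a
  permutation to be the identity.\<close>

lemma permutes_descent_exists:
  fixes n :: nat
  assumes g: "g permutes {1..n}" and "g \<noteq> id"
  shows "\<exists>i\<ge>1. i + 1 \<le> n \<and> g (i + 1) < g i"
proof (rule ccontr)
  assume "\<not> ?thesis"
  then have no_desc: "g i \<le> g (i + 1)" if "1 \<le> i" "i + 1 \<le> n" for i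
    using that by (simp add: not_less)
  have less: "g i < g (i + 1)" if "1 \<le> i" "i + 1 \<le> n" for i
    using no_desc[OF that] permutes_inj[OF g] by (metis inj_eq le_neq_implies_less less_add_one less_irrefl)
  have "x \<le> n \<longrightarrow> x \<le> g x" if "1 \<le> x" for x
    using that
  proof (induction x rule: dec_induct)
    case base
    show ?case using permutes_in_image[OF g, of 1] by auto
  next
    case (step x)
    then show ?case using less[of x] by auto
  qed
  then have "g = id" using permutes_natset_ge[OF g] by simp
  then show False using \<open>g \<noteq> id\<close> by simp
qed

lemma coxeter_length_eq:
  assumes "p permutes {1..n}"
  shows "coxeter_length n p = card (inversions n (inv p))"
  unfolding coxeter_length_def
proof (rule word_length_eqI[where P = "\<lambda>p. p permutes {1..n}"])
  let ?S = "{transpose i (i + 1) | i. 1 \<le> i \<and> i + 1 \<le> n}"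
  have inv_comp: "inv (transpose i j \<circ> p) = inv p \<circ> transpose i j"
    if "p permutes {1..n}" for p and i j :: nat
    using that by (simp add: o_inv_distrib permutes_bij)
  show "id permutes {1..n}" by (rule permutes_id)
  have "inversions n id = {}" by (auto simp: inversions_def)
  then show "card (inversions n (inv id)) = 0" by simp
  show "s \<circ> s = id" if "s \<in> ?S" for s using that by auto
  show "s \<circ> p permutes {1..n}" if "s \<in> ?S" "p permutes {1..n}" for s p
    using that by (auto intro!: permutes_compose permutes_swap_id)
  show "card (inversions n (inv (s \<circ> p))) \<le> card (inversions n (inv p)) + 1"
    if "s \<in> ?S" "p permutes {1..n}" for s p
    using that inv_comp card_inversions_adjacent_le by auto
  show "\<exists>s\<in>?S. card (inversions n (inv (s \<circ> p))) < card (inversions n (inv p))"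
    if p: "p permutes {1..n}" and "p \<noteq> id" for p
  proof -
    have "inv p \<noteq> id" using permutes_inv_inv[OF p] \<open>p \<noteq> id\<close> by auto
    then obtain i where i: "1 \<le> i" "i + 1 \<le> n" "inv p (i + 1) < inv p i"
      using permutes_descent_exists permutes_inv[OF p] by blast
    then have "card (inversions n (inv (transpose i (i + 1) \<circ> p))) < card (inversions n (inv p))"
      using card_inversions_descent inv_comp[OF p] by simp
    then show ?thesis using i by blast
  qed
qed (fact assms)

section \<open>Cuts and sum components\<close>

definition cuts :: "nat list \<Rightarrow> nat set" where
  "cuts w = {k \<in> {1..length w}. set (take k w) = {1..k}}"

lemma finite_cuts: "finite (cuts w)"
  by (simp add: cuts_def)

lemma cuts_indecomposable:
  assumes "perm_word w" "w \<noteq> []" "sum_indecomposable w"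
  shows "cuts w = {length w}"
proof -
  have "k = length w" if k: "k \<in> {1..length w}" "set (take k w) = {1..k}" for k
  proof (rule ccontr)
    assume "k \<noteq> length w"
    then have "perm_word (take k w)" "take k w \<noteq> []" "drop k w \<noteq> []"
      using k assms(1) by (auto simp: perm_word_def)
    then have "\<not> sum_indecomposable (take k w @ drop k w)"
      using assms(1) by (intro prefix_not_indecomposable) simp_all
    then show False using assms(3) by simp
  qed
  moreover have "length w \<in> cuts w"
    using assms by (cases w) (auto simp: cuts_def perm_word_def)
  ultimately show ?thesis by (auto simp: cuts_def)
qed

text \<open>A prefix longer than \<open>u\<close> consists of all of \<open>{1..length u}\<close> and a shifted prefix of \<open>v\<close>, so
  the cuts beyond \<open>u\<close> are the shifted cuts of \<open>v\<close>.\<close>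

lemma cuts_direct_sum:
  assumes u: "perm_word u" and v: "perm_word v"
  shows "cuts (direct_sum u v) = cuts u \<union> (\<lambda>k. k + length u) ` cuts v"
proof -
  let ?m = "length u"
  have set_u: "set u = {1..?m}" using u by (simp add: perm_word_def)
  have low: "k \<in> cuts (direct_sum u v) \<longleftrightarrow> k \<in> cuts u" if "k \<le> ?m" for k
    using that by (auto simp: cuts_def direct_sum_def)
  have shift: "set (take (j + ?m) (direct_sum u v)) = {1..j + ?m} \<longleftrightarrow> set (take j v) = {1..j}" for j
  proof -
    let ?up = "\<lambda>X. {1..?m} \<union> (\<lambda>x. x + ?m) ` X"
    have prefix: "set (take (j + ?m) (direct_sum u v)) = ?up (set (take j v))"
      by (simp add: direct_sum_def take_map set_u)
    have interval: "{1..j + ?m} = ?up {1..j}"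
      unfolding image_add_atLeastAtMost' by auto
    \<comment> \<open>Only the entry \<open>0\<close> would be absorbed into \<open>{1..?m}\<close> by the shift, and words have positive
      entries.\<close>
    have up_inject: "?up X = ?up Y \<longleftrightarrow> X = Y" if "X \<subseteq> {1..}" "Y \<subseteq> {1..}" for X Y :: "nat set"
    proof -
      have recover: "X = {x. 1 \<le> x \<and> x + ?m \<in> ?up X}" if "X \<subseteq> {1..}" for X :: "nat set"
        using that by auto
      show ?thesis using recover[OF that(1)] recover[OF that(2)] by metis
    qed
    have "set (take j v) \<subseteq> {1..}"
      using v set_take_subset[of j v] by (auto simp: perm_word_def)
    then show ?thesis unfolding prefix interval by (rule up_inject) auto
  qed
  have high: "j + ?m \<in> cuts (direct_sum u v) \<longleftrightarrow> j \<in> cuts v" if "j \<ge> 1" for j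
    using that shift[of j] by (auto simp: cuts_def direct_sum_def)
  show ?thesis
  proof (intro set_eqI iffI)
    fix k
    assume k: "k \<in> cuts (direct_sum u v)"
    show "k \<in> cuts u \<union> (\<lambda>k. k + ?m) ` cuts v"
    proof (cases "k \<le> ?m")
      case True
      then show ?thesis using low k by simp
    next
      case False
      then obtain j where "k = j + ?m" "j \<ge> 1"
        by (metis add.commute le_add_diff_inverse less_imp_le not_le zero_less_diff less_one)
      then show ?thesis using high k by blast
    qed
  next
    fix k
    assume "k \<in> cuts u \<union> (\<lambda>k. k + ?m) ` cuts v"
    then show "k \<in> cuts (direct_sum u v)"
      using low high by (auto simp: cuts_def)
  qed
qed

lemma perm_word_foldr_direct_sum:
  "\<forall>u\<in>set ws. perm_word u \<Longrightarrow> perm_word (foldr direct_sum ws [])"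
  by (induction ws) (simp_all add: perm_word_direct_sum, simp add: perm_word_def)

lemma card_cuts_sum_decomposition:
  assumes "sum_decomposition w ws"
  shows "card (cuts w) = length ws"
proof -
  have "card (cuts (foldr direct_sum ws [])) = length ws"
    if "\<forall>u\<in>set ws. perm_word u \<and> u \<noteq> [] \<and> sum_indecomposable u"
    using that
  proof (induction ws)
    case Nil
    then show ?case by (simp add: cuts_def)
  next
    case (Cons u us)
    let ?v = "foldr direct_sum us []"
    have u: "perm_word u" "u \<noteq> []" "sum_indecomposable u" using Cons.prems by auto
    have v: "perm_word ?v" using Cons.prems by (intro perm_word_foldr_direct_sum) auto
    have "cuts (direct_sum u ?v) = {length u} \<union> (\<lambda>k. k + length u) ` cuts ?v"
      using cuts_direct_sum[OF u(1) v] cuts_indecomposable[OF u] by simp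
    moreover have "length u \<notin> (\<lambda>k. k + length u) ` cuts ?v" by (auto simp: cuts_def)
    moreover have "card ((\<lambda>k. k + length u) ` cuts ?v) = card (cuts ?v)"
      by (simp add: card_image)
    ultimately show ?case using Cons by (simp add: finite_cuts)
  qed
  then show ?thesis using assms by (auto simp: sum_decomposition_def)
qed

lemma num_sum_components_eq_card_cuts:
  assumes "p permutes {1..n}"
  shows "num_sum_components n p = card (cuts (one_line n p))"
  using card_cuts_sum_decomposition[OF sum_decomposition_sum_components[OF assms]]
  by (simp add: num_sum_components_def)

section \<open>Cuts and connected components\<close>

lemma mem_cuts_one_line:
  "k \<in> cuts (one_line n p) \<longleftrightarrow> k \<in> {1..n} \<and> p ` {1..k} = {1..k}"
proof -
  have "set (take k (one_line n p)) = p ` {1..k}" if "k \<le> n"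
  proof -
    have "take k [1..<n + 1] = [1..<k + 1]" using that by (subst take_upt) auto
    moreover have "set [1..<k + 1] = {1..k}" by auto
    ultimately show ?thesis by (simp add: one_line_def take_map del: upt_Suc)
  qed
  then show ?thesis by (auto simp: cuts_def one_line_def simp del: upt_Suc)
qed

text \<open>If no edge crosses \<open>k\<close>, the positions of the values at most \<open>k\<close> form an initial segment of
  \<open>{1..n}\<close>, and this segment has \<open>k\<close> elements.\<close>

lemma cut_iff_no_crossing_edge:
  fixes n :: nat
  assumes p: "p permutes {1..n}" and k: "k \<in> {1..n}"
  shows "p ` {1..k} = {1..k}
    \<longleftrightarrow> (\<forall>a\<in>{1..k}. \<forall>b\<in>{k+1..n}. inv p a < inv p b)"
proof
  assume cut: "p ` {1..k} = {1..k}"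
  have inv_cut: "inv p ` {1..k} = {1..k}"
    using image_inv_f_f[OF permutes_inj[OF p], of "{1..k}"] by (simp only: cut)
  show "\<forall>a\<in>{1..k}. \<forall>b\<in>{k+1..n}. inv p a < inv p b"
  proof (intro ballI)
    fix a b
    assume a: "a \<in> {1..k}" and b: "b \<in> {k+1..n}"
    have "inv p a \<le> k" using a inv_cut by auto
    moreover have "inv p b \<notin> {1..k}"
    proof
      assume "inv p b \<in> {1..k}"
      then have "p (inv p b) \<in> {1..k}" using cut by blast
      then show False using b by (auto simp: permutes_inverses[OF p])
    qed
    moreover have "inv p b \<in> {1..n}"
      using b permutes_in_image[OF permutes_inv[OF p], of b] by simp
    ultimately show "inv p a < inv p b" by auto
  qed
next
  assume no: "\<forall>a\<in>{1..k}. \<forall>b\<in>{k+1..n}. inv p a < inv p b"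
  have card: "card (inv p ` {1..k}) = k"
    using permutes_inj_on[OF permutes_inv[OF p]] by (subst card_image) auto
  have "inv p a \<in> {1..k}" if a: "a \<in> {1..k}" for a
  proof -
    have a_in: "inv p a \<in> {1..n}"
      using a k permutes_in_image[OF permutes_inv[OF p], of a] by simp
    have "{1..inv p a} \<subseteq> inv p ` {1..k}"
    proof
      fix y
      assume y: "y \<in> {1..inv p a}"
      have "p y \<in> {1..n}" using y a_in permutes_in_image[OF p, of y] by simp
      moreover have "p y \<notin> {k+1..n}"
      proof
        assume "p y \<in> {k+1..n}"
        then have "inv p a < inv p (p y)" using no a by blast
        then show False using y by (simp add: permutes_inverses[OF p])
      qed
      ultimately have "p y \<in> {1..k}" by auto
      then have "inv p (p y) \<in> inv p ` {1..k}" by blast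
      then show "y \<in> inv p ` {1..k}" by (simp add: permutes_inverses[OF p])
    qed
    then have "card {1..inv p a} \<le> card (inv p ` {1..k})" by (intro card_mono) simp_all
    then have "inv p a \<le> k" unfolding card by simp
    then show ?thesis using a_in by simp
  qed
  then have "inv p ` {1..k} = {1..k}"
    by (intro endo_inj_surj permutes_inj_on[OF permutes_inv[OF p]] image_subsetI) simp_all
  then show "p ` {1..k} = {1..k}"
    using image_f_inv_f[OF permutes_surj[OF p], of "{1..k}"] by simp
qed

definition connected :: "nat \<Rightarrow> (nat \<Rightarrow> nat) \<Rightarrow> (nat \<times> nat) set" where
  "connected n p = {(u, v). u \<in> {1..n} \<and> v \<in> {1..n} \<and>
     (u, v) \<in> {(x, y). {x, y} \<in> snd (inversion_graph n p)}\<^sup>*}"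

lemma connected_components_inversion_graph:
  "connected_components (inversion_graph n p) = {1..n} // connected n p"
  by (simp add: connected_components_def connected_def inversion_graph_def)

lemma equiv_connected: "equiv {1..n} (connected n p)"
proof -
  have "sym {(x, y). {x, y} \<in> snd (inversion_graph n p)}"
    by (rule symI) (simp add: insert_commute)
  then have "sym ({(x, y). {x, y} \<in> snd (inversion_graph n p)}\<^sup>*)" by (rule sym_rtrancl)
  then have "sym (connected n p)" unfolding connected_def sym_def by blast
  moreover have "trans (connected n p)"
    unfolding connected_def by (rule transI) (auto intro: rtrancl_trans)
  ultimately show ?thesis
    by (intro equivI) (auto simp: connected_def refl_on_def)
qed

lemma connected_if_inversion:
  assumes "a \<in> {1..n}" "b \<in> {1..n}" "a < b" "inv p b < inv p a"
  shows "(a, b) \<in> connected n p"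
proof -
  have "{a, b} \<in> snd (inversion_graph n p)"
    unfolding inversion_graph_def snd_conv using assms by blast
  then show ?thesis using assms by (auto simp: connected_def)
qed

lemma connected_same_side_of_cut:
  assumes p: "p permutes {1..n}" and k: "k \<in> cuts (one_line n p)" and "(x, y) \<in> connected n p"
  shows "x \<le> k \<longleftrightarrow> y \<le> k"
proof -
  have no: "inv p a < inv p b" if "a \<in> {1..n}" "a \<le> k" "b \<in> {1..n}" "k < b" for a b
    using that k cut_iff_no_crossing_edge[OF p, of k] unfolding mem_cuts_one_line by simp
  have "(x, y) \<in> {(x, y). {x, y} \<in> snd (inversion_graph n p)}\<^sup>*"
    using assms(3) by (simp add: connected_def)
  then show ?thesis
  proof (induction rule: rtrancl_induct)
    case base
    show ?case ..
  next
    case (step y z)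
    from step.hyps(2) obtain a b
      where ab: "{y, z} = {a, b}" "a \<in> {1..n}" "b \<in> {1..n}" "a < b" "inv p b < inv p a"
      unfolding inversion_graph_def mem_Collect_eq prod.case snd_conv by blast
    then have "a \<le> k \<longleftrightarrow> b \<le> k" using no[of a b] by force
    then show ?case using step.IH ab(1) by (auto simp: doubleton_eq_iff)
  qed
qed

text \<open>Suppose an edge joins \<open>a \<le> m\<close> to \<open>b > m\<close>, so that \<open>b\<close> stands to the left of \<open>a\<close>. Wherever
  \<open>m\<close> stands, it is to the right of \<open>b\<close> or to the left of \<open>a\<close>; in either case \<open>m\<close> is connected
  to \<open>b\<close>, directly or through \<open>a\<close>, and is not the largest value in its component.\<close>

lemma component_max_is_cut:
  assumes p: "p permutes {1..n}" and m: "m \<in> {1..n}"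
    and max: "\<And>y. (m, y) \<in> connected n p \<Longrightarrow> y \<le> m"
  shows "m \<in> cuts (one_line n p)"
proof -
  have "inv p a < inv p b" if a: "a \<in> {1..m}" and b: "b \<in> {m+1..n}" for a b
  proof (rule ccontr)
    assume "\<not> inv p a < inv p b"
    moreover have "inv p a \<noteq> inv p b"
      using a b inj_eq[OF permutes_inj[OF permutes_inv[OF p]], of a b] by simp
    ultimately have ba: "inv p b < inv p a" by simp
    have "(m, b) \<in> connected n p"
    proof (cases "inv p b < inv p m")
      case True
      then show ?thesis using m b by (intro connected_if_inversion) auto
    next
      case False
      then have ma: "inv p m < inv p a" using ba by simp
      then have "a \<noteq> m" by auto
      then have "(a, m) \<in> connected n p" using ma a m by (intro connected_if_inversion) auto
      moreover have "(a, b) \<in> connected n p" using ba a b m by (intro connected_if_inversion) auto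
      ultimately show ?thesis using equiv_connected[of n p] by (meson equivE symD transD)
    qed
    then show False using max b by fastforce
  qed
  then show ?thesis
    unfolding mem_cuts_one_line using cut_iff_no_crossing_edge[OF p m] m by blast
qed

lemma card_connected_components:
  assumes p: "p permutes {1..n}"
  shows "card (connected_components (inversion_graph n p)) = card (cuts (one_line n p))"
proof -
  let ?R = "connected n p"
  have "bij_betw (\<lambda>k. ?R `` {k}) (cuts (one_line n p)) ({1..n} // ?R)"
  proof (rule bij_betwI')
    fix k l
    assume k: "k \<in> cuts (one_line n p)" and l: "l \<in> cuts (one_line n p)"
    then have kl_in: "k \<in> {1..n}" "l \<in> {1..n}" by (auto simp: mem_cuts_one_line)
    show "?R `` {k} = ?R `` {l} \<longleftrightarrow> k = l"
    proof
      assume "?R `` {k} = ?R `` {l}"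
      then have "(k, l) \<in> ?R"
        using eq_equiv_class_iff[OF equiv_connected kl_in] by simp
      then show "k = l"
        using connected_same_side_of_cut[OF p k] connected_same_side_of_cut[OF p l] by force
    qed simp
  next
    fix k
    assume "k \<in> cuts (one_line n p)"
    then show "?R `` {k} \<in> {1..n} // ?R" by (intro quotientI) (simp add: mem_cuts_one_line)
  next
    fix C
    assume C: "C \<in> {1..n} // ?R"
    have sub: "C \<subseteq> {1..n}" using C in_quotient_imp_subset[OF equiv_connected] by blast
    then have fin: "finite C" by (rule finite_subset) simp
    have ne: "C \<noteq> {}" using C in_quotient_imp_non_empty[OF equiv_connected] by blast
    have max_in: "Max C \<in> C" using fin ne by (rule Max_in)
    have class_eq: "C = ?R `` {Max C}"
      using C max_in equiv_connected[of n p] by (metis Image_singleton_iff equiv_class_eq quotientE)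
    have "Max C \<in> cuts (one_line n p)"
    proof (rule component_max_is_cut[OF p])
      show "Max C \<in> {1..n}" using max_in sub by blast
      show "y \<le> Max C" if "(Max C, y) \<in> ?R" for y
        using that fin by (subst (asm) Image_singleton_iff[symmetric], fold class_eq) (rule Max_ge)
    qed
    then show "\<exists>k\<in>cuts (one_line n p). C = ?R `` {k}" using class_eq by blast
  qed
  then show ?thesis by (simp add: bij_betw_same_card connected_components_inversion_graph)
qed

section \<open>The identity\<close>

theorem theorem1p4:
  fixes n :: nat and \<pi> :: "nat \<Rightarrow> nat"
  assumes "n \<ge> 1" and "\<pi> permutes {1..n}"
  shows "int (coxeter_length n \<pi>) - int (reflection_length n \<pi>) =
    cyclomatic_number (inversion_graph n \<pi>) + (int (num_cycles n \<pi>) - int (num_sum_components n \<pi>))"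
proof -
  have "fst (inversion_graph n \<pi>) = {1..n}" by (simp add: inversion_graph_def)
  then have "cyclomatic_number (inversion_graph n \<pi>) =
      int (coxeter_length n \<pi>) - int n + int (num_sum_components n \<pi>)"
    using assms(2)
    by (simp add: cyclomatic_number_def card_inversion_graph_edges coxeter_length_eq
        card_connected_components num_sum_components_eq_card_cuts)
  moreover have "int (reflection_length n \<pi>) = int n - int (num_cycles n \<pi>)"
    using reflection_length_eq[OF assms(2)] num_cycles_le[of n \<pi>] by simp
  ultimately show ?thesis by simp
qed

end
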